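(* Let $\mathit{Exp}$ be the set of conditional expressions over a set $A$ of symbols, and let $\prec_2$ be the recursion relation on $\mathit{Exp}$ of the nested-recursive normalization function $norm_2$, as defined in the context. Then $\prec_2$ is well-founded; that is, for every predicate $P$ on $\mathit{Exp}$, $$\Bigl(\forall x.\,\bigl(\forall x'.\,x'\prec_2 x\Rightarrow P(x')\bigr)\Rightarrow P(x)\Bigr)\;\Longrightarrow\;\forall x.\,P(x),$$ where $x,x'$ range over $\mathit{Exp}$.
   Context: Fix a set $A$ of symbols. The set $\mathit{Exp}$ of conditional expressions is the inductive type freely generated by the constructors $At(a)$ for $a\in A$ and $\mathit{If}(x,y,z)$ for $x,y,z\in\mathit{Exp}$. The predicate $ISN$ ("is in normal form") on $\mathit{Exp}$ is defined recursively by $$ISN(At(a))\iff\textit{true},\qquad ISN(\mathit{If}(At(a),y,z))\iff ISN(y)\wedge ISN(z),$$ $$ISN(\mathit{If}(\mathit{If}(u,v,w),y,z))\iff\textit{false}.$$ The function $norm_2$ is given by the recursion equations $$norm_2(At(a))=At(a),\qquad norm_2(\mathit{If}(At(a),y,z))=\mathit{If}(At(a),norm_2(y),norm_2(z)),$$ $$norm_2(\mathit{If}(\mathit{If}(u,v,w),y,z))=norm_2\bigl(\mathit{If}(u,\,norm_2(\mathit{If}(v,y,z)),\,norm_2(\mathit{If}(w,y,z)))\bigr).$$ Its recursion relation $\prec_2$ on $\mathit{Exp}$, in which the results of inner calls are represented by arbitrary normal expressions, is defined by cases on the right-hand argument: $$x\prec_2 At(a)\iff\textit{false},$$ $$x\prec_2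 \mathit{If}(At(a),y,z)\iff x=y\lor x=z,$$ $$x\prec_2 \mathit{If}(\mathit{If}(u,v,w),y,z)\iff x=\mathit{If}(v,y,z)\;\lor\;x=\mathit{If}(w,y,z)\;\lor\;\exists v'\,w'.\,ISN(v')\wedge ISN(w')\wedge x=\mathit{If}(u,v',w').$$ A relation is called well-founded if its rule of well-founded induction is sound for every predicate $P$. *)

theory Defs
  imports Main
begin

text \<open>
  The set of symbols is the type parameter.  The constructor \<open>IF\<close> is in upper case
  because \<open>If\<close> is the conditional of HOL.
\<close>

datatype 'a cexp = At 'a | IF "'a cexp" "'a cexp" "'a cexp"

fun ISN :: "'a cexp \<Rightarrow> bool" where
  "ISN (At a) \<longleftrightarrow> True"
| "ISN (IF (At a) y z) \<longleftrightarrow> ISN y \<and> ISN z"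
| "ISN (IF (IF u v w) y z) \<longleftrightarrow> False"

text \<open>
  \<open>prec2 x' x\<close> says that \<open>x'\<close> is the argument of a recursive call made by
  \<open>norm2 x\<close>, for the nested recursion

    \<open>norm2 (At a) = At a\<close>,
    \<open>norm2 (IF (At a) y z) = IF (At a) (norm2 y) (norm2 z)\<close>,
    \<open>norm2 (IF (IF u v w) y z) = norm2 (IF u (norm2 (IF v y z)) (norm2 (IF w y z)))\<close>,

  where the results of the two inner calls are replaced by arbitrary normal expressions
  \<open>v'\<close> and \<open>w'\<close>, so that the relation does not refer to \<open>norm2\<close> itself.
\<close>

fun prec2 :: "'a cexp \<Rightarrow> 'a cexp \<Rightarrow> bool" where
  "prec2 x (At a) \<longleftrightarrow> False"
| "prec2 x (IF (At a) y z) \<longleftrightarrow> x = y \<or> x = z"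
| "prec2 x (IF (IF u v w) y z) \<longleftrightarrow>
     x = IF v y z \<or> x = IF w y z \<or> (\<exists>v' w'. ISN v' \<and> ISN w' \<and> x = IF u v' w')"

end

theory Submission
  imports Defs
begin

text \<open>
  Structural induction on the condition \<open>x\<close> shows that \<open>IF x y z\<close> is accessible whenever
  \<open>y\<close> and \<open>z\<close> are.  For \<open>x = IF u v w\<close> the inner calls keep \<open>y\<close> and \<open>z\<close> and have the smaller
  conditions \<open>v\<close> and \<open>w\<close>; the outer call has the condition \<open>u\<close>, and its branches are
  normal and hence already known to be accessible.
\<close>

lemma accp_prec2_At: "Wellfounded.accp prec2 (At a)"
  by (rule accp.accI) simp

lemma accp_prec2_IF_At:
  assumes "Wellfounded.accp prec2 y" "Wellfounded.accp prec2 z"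
  shows "Wellfounded.accp prec2 (IF (At a) y z)"
  using assms by (auto intro: accp.accI)

text \<open>A normal expression has only atomic conditions, so the calls below it just descend into
  its branches, which are normal again.\<close>

lemma ISN_imp_accp_prec2: "ISN x \<Longrightarrow> Wellfounded.accp prec2 x"
  by (induction x rule: ISN.induct) (auto intro: accp_prec2_At accp_prec2_IF_At)

lemma accp_prec2_IF:
  assumes "Wellfounded.accp prec2 y" "Wellfounded.accp prec2 z"
  shows "Wellfounded.accp prec2 (IF x y z)"
  using assms
\<comment> \<open>The branches are generalized because the outer call \<open>IF u v' w'\<close>
  needs the induction hypothesis for \<open>u\<close> at the new branches \<open>v'\<close> and
  \<open>w'\<close>.\<close>
proof (induction x arbitrary: y z)
  case (At a)
  then show ?case by (rule accp_prec2_IF_At)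
next
  case (IF u v w)
  show ?case
  proof (rule accp.accI)
    fix t assume "prec2 t (IF (IF u v w) y z)"
    then show "Wellfounded.accp prec2 t"
      using IF by (auto intro: ISN_imp_accp_prec2)
  qed
qed

theorem mainTheorem5:
  shows "wfp (prec2 :: 'a cexp \<Rightarrow> 'a cexp \<Rightarrow> bool)"
proof (rule accp_wfpI, rule allI)
  fix x :: "'a cexp"
  show "Wellfounded.accp prec2 x"
    \<comment> \<open>The induction hypotheses for the two branches are the premises of
      \<open>accp_prec2_IF\<close>.\<close>
    by (induction x) (auto intro: accp_prec2_At accp_prec2_IF)
qed

end
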